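(* There is an online advice strategy for bin covering, namely $\mathsf{DH}^{b+\lg n}_4$ described in the context, that reads $O(b+\log n)$ bits of advice and satisfies, for every input sequence $\sigma$ of length $n$, $$|\mathsf{DH}^{b+\lg n}_4(\sigma)| \ge \frac{2}{3}\,|\mathsf{OPT}(\sigma)| - \frac{173}{60},$$ where $b$ is the number of bits required to represent any rational value in $\sigma$, $|\mathsf{OPT}(\sigma)|$ is the maximum number of bins that can be covered with the items of $\sigma$, and $|\mathsf{DH}^{b+\lg n}_4(\sigma)|$ is the number of bins covered by the strategy.
   Context: Bin covering: given a sequence $\sigma$ of items with rational sizes, each item size $v$ satisfying $0<v<1$, partition the items into bins; the load of a bin is the sum of its item sizes and a bin is covered if its load is at least $1$; the goal is to maximize the number of covered bins. Online: items arrive one by one and each must be irrevocably placed in a bin (existing or newly opened) before the next arrives. Advice model: an oracle knowing the entire input and the strategy writes a bit string on an advice tape which the strategy may read; all advice is written in a self-delimiting encoding $e(s)=u(s)\circ b(s)\circ s$, where $b(s)$ is the binary encoding of the length of $s$ and $u(s)$ is $|b(s)|$ ones followed by a zero; the advice complexity is the number of bits read. Dual Next Fit (DNF) on a stream of items: keep one active bin, put each item into it, and when it becomes covered close it and open a new empty active bin. Let $k=4$. For an integer $2\le t\le k$, an item $v$ is a $t$-item if $1/t\le v<1/(t-1)$; an item $v<1/k$ is small. Let $x_1\ge x_2\ge\dots\ge x_n$ be the items of $\sigma$ sorted in non-increasing order. Strategy $\mathsf{DH}^{b+\lg n}_k$: it first reads from the advice an integer $m$ and the value $x_m$ (the $m$-th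 largest item of $\sigma$). It opens $m$ critical bins, each with an initial virtual load of $x_m$; it also opens one $t$-bin for each $t\in\{2,\dots,k\}$ and one small bin. The virtual load of a critical bin equals the sum of its small items plus either $x_m$ (if it contains no item of size $\ge x_m$ yet) or the actual size of the item of size $\ge x_m$ it contains. When an item $v$ arrives: (1) if $x_m\le v$, place $v$ in the next critical bin that does not yet contain such a (2-)item and update its virtual load; (2) if $1/k\le v<x_m$ and $v$ is a $t$-item, place $v$ in the current $t$-bin using DNF (when it becomes covered, close it and open a new $t$-bin); (3) if $v<1/k$, place $v$ in the next critical bin whose virtual load is still below $1$ and update its virtual load; if all critical bins have virtual load at least $1$, place $v$ in the small bin using DNF (when it becomes covered, close it and open a new small bin). The oracle chooses $m$ by emulating the strategy for every integer $0\le m\le n_2$, where $n_2$ is the number of $2$-items in $\sigma$, and reports (self-delimitingly encoded) a value of $m$ for which the strategy covers as many bins as possible, together with the exact rational value $x_m$. *)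

theory Defs
  imports Complex_Main
begin

definition valid_input :: "rat list \<Rightarrow> bool" where
  "valid_input \<sigma> \<longleftrightarrow> (\<forall>v\<in>set \<sigma>. 0 < v \<and> v < 1)"

definition covered_bins :: "rat list \<Rightarrow> (nat \<Rightarrow> nat) \<Rightarrow> nat" where
  "covered_bins \<sigma> g = card {j. 1 \<le> (\<Sum>i\<in>{i. i < length \<sigma> \<and> g i = j}. \<sigma> ! i)}"

definition OPT :: "rat list \<Rightarrow> nat" where
  "OPT \<sigma> = Max {covered_bins \<sigma> g | g. True}"

fun bin :: "nat \<Rightarrow> bool list" where
  "bin n = (if n = 0 then [] else bin (n div 2) @ [odd n])"

definition bin_val :: "bool list \<Rightarrow> nat" where
  "bin_val bs = foldl (\<lambda>a b. 2 * a + (if b then 1 else 0)) 0 bs"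

definition enc :: "nat \<Rightarrow> bool list" where
  "enc n = (let s = bin n; bs = bin (length s) in replicate (length bs) True @ [False] @ bs @ s)"

definition dec :: "bool list \<Rightarrow> nat \<times> bool list" where
  "dec xs = (let k = length (takeWhile id xs); r = drop (Suc k) xs;
                 L = bin_val (take k r); r2 = drop k r
             in (bin_val (take L r2), drop L r2))"

definition rat_bits :: "rat \<Rightarrow> nat" where
  "rat_bits r = (case quotient_of r of (p, q) \<Rightarrow> length (bin (nat \<bar>p\<bar>)) + length (bin (nat q)))"

definition bits :: "rat list \<Rightarrow> nat" where
  "bits \<sigma> = Max (insert 0 (rat_bits ` set \<sigma>))"

definition tclass :: "rat \<Rightarrow> nat" where
  "tclass v = (if 1/2 \<le> v then 2 else if 1/3 \<le> v then 3 else 4)"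

fun upd_first :: "('a \<Rightarrow> bool) \<Rightarrow> ('a \<Rightarrow> 'a) \<Rightarrow> 'a list \<Rightarrow> 'a list option" where
  "upd_first P f [] = None"
| "upd_first P f (x # xs) = (if P x then Some (f x # xs) else map_option ((#) x) (upd_first P f xs))"

text \<open>Dual Next Fit step on one active bin: (load, number of closed covered bins).\<close>
definition dnf_step :: "rat \<times> nat \<Rightarrow> rat \<Rightarrow> rat \<times> nat" where
  "dnf_step lc v = (if 1 \<le> fst lc + v then (0, Suc (snd lc)) else (fst lc + v, snd lc))"

text \<open>A critical bin: (its item of size >= x_m, if any; total size of its small items).\<close>
type_synonym cbin = "rat option \<times> rat"

definition vload :: "rat \<Rightarrow> cbin \<Rightarrow> rat" where
  "vload xm c = snd c + (case fst c of None \<Rightarrow> xm | Some w \<Rightarrow> w)"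

definition aload :: "cbin \<Rightarrow> rat" where
  "aload c = snd c + (case fst c of None \<Rightarrow> 0 | Some w \<Rightarrow> w)"

text \<open>State: critical bins, t-bins (indexed by t: active load and number closed), small bin.\<close>
type_synonym dh_state = "cbin list \<times> (nat \<Rightarrow> rat \<times> nat) \<times> (rat \<times> nat)"

definition dh_step :: "rat \<Rightarrow> dh_state \<Rightarrow> rat \<Rightarrow> dh_state" where
  "dh_step xm st v = (case st of (crit, tb, sb) \<Rightarrow>
     (case (if xm \<le> v then upd_first (\<lambda>c. fst c = None) (\<lambda>c. (Some v, snd c)) crit else None) of
        Some crit' \<Rightarrow> (crit', tb, sb)
      | None \<Rightarrow>
         (if 1/4 \<le> v then (crit, tb(tclass v := dnf_step (tb (tclass v)) v), sb)
          else (case upd_first (\<lambda>c. vload xm c < 1) (\<lambda>c. (fst c, snd c + v)) crit of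
                  Some crit' \<Rightarrow> (crit', tb, sb)
                | None \<Rightarrow> (crit, tb, dnf_step sb v)))))"

definition dh_run :: "nat \<Rightarrow> rat \<Rightarrow> rat list \<Rightarrow> dh_state" where
  "dh_run m xm \<sigma> = foldl (dh_step xm) (replicate m (None, 0), \<lambda>_. (0, 0), (0, 0)) \<sigma>"

definition dh_covered :: "dh_state \<Rightarrow> nat" where
  "dh_covered st = (case st of (crit, tb, sb) \<Rightarrow>
     length (filter (\<lambda>c. 1 \<le> aload c) crit) + snd (tb 2) + snd (tb 3) + snd (tb 4) + snd sb)"

definition DH_read :: "bool list \<Rightarrow> nat \<times> rat \<times> bool list" where
  "DH_read tape = (let (m, r1) = dec tape; (p, r2) = dec r1; (q, r3) = dec r2
                   in (m, of_nat p / of_nat q, r3))"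

definition DH :: "bool list \<Rightarrow> rat list \<Rightarrow> nat" where
  "DH tape \<sigma> = (case DH_read tape of (m, xm, _) \<Rightarrow> dh_covered (dh_run m xm \<sigma>))"

definition advice_bits_read :: "bool list \<Rightarrow> nat" where
  "advice_bits_read tape = (case DH_read tape of (_, _, rest) \<Rightarrow> length tape - length rest)"

definition n2 :: "rat list \<Rightarrow> nat" where
  "n2 \<sigma> = length (filter (\<lambda>v. 1/2 \<le> v) \<sigma>)"

text \<open>x_m: m-th largest item (1-based); convention x_0 = 1 (no critical bins).\<close>
definition xm_of :: "rat list \<Rightarrow> nat \<Rightarrow> rat" where
  "xm_of \<sigma> m = (if m = 0 then 1 else rev (sort \<sigma>) ! (m - 1))"

definition advisor_m :: "rat list \<Rightarrow> nat" where
  "advisor_m \<sigma> = (SOME m. m \<le> n2 \<sigma> \<and>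
      (\<forall>m'\<le>n2 \<sigma>. dh_covered (dh_run m' (xm_of \<sigma> m') \<sigma>) \<le> dh_covered (dh_run m (xm_of \<sigma> m) \<sigma>)))"

definition advisor :: "rat list \<Rightarrow> bool list" where
  "advisor \<sigma> = (let m = advisor_m \<sigma>; (p, q) = quotient_of (xm_of \<sigma> m)
               in enc m @ enc (nat p) @ enc (nat q))"

end

theory Submission
  imports Defs "HOL-Library.Multiset"
begin

text \<open>
  Give a \<open>t\<close>-item (\<open>t = 2, 3, 4\<close>) the weight \<open>1/t\<close> and a small item \<open>v\<close> the weight \<open>2/3 * v\<close>. The
  covered bins of an optimal packing have weight at least \<open>2/3\<close>, except for, say, \<open>a\<close> light ones,
  which consist of one 2-item \<open>y > 3/4\<close> and small items of total size between \<open>1 - y\<close> and \<open>1/4\<close>.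
  Call \<open>m\<close> feasible if the small items suffice to fill \<open>m\<close> critical bins up to virtual load 1. For
  feasible \<open>m\<close>, a critical bin gains \<open>1/2\<close> over pairing its 2-item in the 2-bin, at the price of at
  most \<open>1/4 + (1 - x_m)\<close> small mass, while about \<open>a - m\<close> light bins contain small mass at least
  \<open>1 - x_m\<close> each.

  If \<open>m = \<lfloor>a/2\<rfloor>\<close> is feasible, the light bins therefore pay for the \<open>1 - x_m\<close>, and the net gain of
  about \<open>m/3 = a/6\<close> compensates the light bins. Otherwise take \<open>m < \<lfloor>a/2\<rfloor>\<close> feasible with \<open>m + 1\<close>
  infeasible, put \<open>d = 1 - x_{m+1} < 1/4\<close>, and count small items with \<open>min v d\<close>. Infeasibility
  bounds the total by \<open>(2 m + 1) d\<close>, the light bins account for \<open>(a - m) d\<close> of it, and so the small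
  items outside the light bins have total size below \<open>(3 m + 1 - a) / 4\<close>; even if all small items go
  to critical bins, the gain \<open>m/2\<close> outweighs this.
\<close>

section \<open>The advice encoding\<close>

declare bin.simps [simp del]

lemma bin_val_snoc: "bin_val (bs @ [b]) = 2 * bin_val bs + (if b then 1 else 0)"
  by (simp add: bin_val_def)

lemma bin_val_bin: "bin_val (bin n) = n"
proof (induction n rule: less_induct)
  case (less n)
  show ?case
  proof (cases "n = 0")
    case True
    then show ?thesis by (simp add: bin.simps[of 0] bin_val_def)
  next
    case False
    then have "bin n = bin (n div 2) @ [odd n]" by (simp add: bin.simps[of n])
    moreover have "bin_val (bin (n div 2)) = n div 2" using False less by simp
    ultimately show ?thesis by (auto simp: bin_val_snoc)
  qed
qed

text \<open>The unary block ends at its first \<open>False\<close> and gives the length of the next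
  block, which in turn gives the length of the last one. So decoding stops exactly at the end of the
  codeword, whatever follows, and codewords can be concatenated.\<close>

lemma dec_enc: "dec (enc n @ rest) = (n, rest)"
proof -
  define bs where "bs = bin (length (bin n))"
  have e: "enc n @ rest = replicate (length bs) True @ False # bs @ bin n @ rest"
    by (simp add: enc_def bs_def Let_def)
  have k: "length (takeWhile id (enc n @ rest)) = length bs"
    by (simp add: e takeWhile_append)
  have r: "drop (Suc (length bs)) (enc n @ rest) = bs @ bin n @ rest"
    by (simp add: e)
  have "bin_val bs = length (bin n)" by (simp add: bs_def bin_val_bin)
  then show ?thesis
    unfolding dec_def Let_def k r by (simp add: bin_val_bin)
qed

lemma length_bin_le: "length (bin n) \<le> n"
proof (induction n rule: less_induct)
  case (less n)
  show ?case
  proof (cases "n = 0")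
    case True
    then show ?thesis by (simp add: bin.simps[of 0])
  next
    case False
    then have "length (bin n) = Suc (length (bin (n div 2)))" by (simp add: bin.simps[of n])
    moreover have "length (bin (n div 2)) \<le> n div 2" using False less by simp
    ultimately show ?thesis using False by linarith
  qed
qed

lemma two_power_length_bin: "n > 0 \<Longrightarrow> 2 ^ length (bin n) \<le> 2 * n"
proof (induction n rule: less_induct)
  case (less n)
  have l: "length (bin n) = Suc (length (bin (n div 2)))" using less.prems by (simp add: bin.simps[of n])
  show ?case
  proof (cases "n div 2 = 0")
    case True
    then show ?thesis using l less.prems by (simp add: bin.simps[of 0])
  next
    case False
    then have "2 ^ length (bin (n div 2)) \<le> 2 * (n div 2)" using less by simp
    then show ?thesis using l by simp
  qed
qed

lemma length_bin_log: "real (length (bin n)) \<le> 1 + log 2 (real n + 1)"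
proof (cases "n = 0")
  case True
  then show ?thesis by (simp add: bin.simps[of 0])
next
  case False
  then have "real (2 ^ length (bin n)) \<le> real (2 * n)"
    using two_power_length_bin[of n] by linarith
  then have "2 powr real (length (bin n)) \<le> 2 * (real n + 1)"
    by (simp add: powr_realpow)
  then have "real (length (bin n)) \<le> log 2 (2 * (real n + 1))"
    using False by (subst le_log_iff) auto
  also have "\<dots> = 1 + log 2 (real n + 1)"
    by (subst log_mult) auto
  finally show ?thesis .
qed

text \<open>Both header blocks have the length of \<open>bin (length (bin n))\<close>, and the crude
  bound \<open>length_bin_le\<close> already makes this linear in
  \<open>length (bin n)\<close>.\<close>

lemma length_enc: "length (enc n) \<le> 3 * length (bin n) + 1"
  using length_bin_le[of "length (bin n)"] by (simp add: enc_def Let_def)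

lemma DH_read_encoding:
  assumes "0 < x" "quotient_of x = (p, q)"
  shows "DH_read (enc m @ enc (nat p) @ enc (nat q)) = (m, x, [])"
proof -
  have "q > 0" by (rule quotient_of_denom_pos[OF assms(2)])
  moreover have x: "x = of_int p / of_int q" by (rule quotient_of_div[OF assms(2)])
  ultimately have "p > 0" using assms(1) by (simp add: zero_less_divide_iff)
  have d: "dec (enc (nat q)) = (nat q, [])" using dec_enc[of "nat q" "[]"] by simp
  show ?thesis
    using \<open>q > 0\<close> \<open>p > 0\<close> by (simp add: DH_read_def dec_enc d x of_nat_nat)
qed

section \<open>The run of the strategy\<close>

definition small_part :: "rat \<Rightarrow> rat" where
  "small_part v = (if v < 1/4 then v else 0)"

text \<open>\<open>tclass\<close> sends every item below 1/3 to 4, small ones included; hence the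
  extra test.\<close>

definition class_count :: "nat \<Rightarrow> rat list \<Rightarrow> nat" where
  "class_count t \<sigma> = length (filter (\<lambda>v. 1/4 \<le> v \<and> tclass v = t) \<sigma>)"

definition occupied :: "cbin list \<Rightarrow> nat" where
  "occupied crit = length (filter (\<lambda>c. fst c \<noteq> None) crit)"

lemma upd_first_SomeD:
  "upd_first P f xs = Some ys \<Longrightarrow>
   \<exists>as x bs. xs = as @ x # bs \<and> (\<forall>a\<in>set as. \<not> P a) \<and> P x \<and> ys = as @ f x # bs"
proof (induction xs arbitrary: ys)
  case Nil
  then show ?case by simp
next
  case (Cons x xs)
  show ?case
  proof (cases "P x")
    case True
    then show ?thesis using Cons.prems
      by (intro exI[of _ "[]"] exI[of _ x] exI[of _ xs]) auto
  next
    case False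
    then obtain zs where zs: "upd_first P f xs = Some zs" "ys = x # zs"
      using Cons.prems by auto
    from Cons.IH[OF zs(1)] obtain as y bs where
      "xs = as @ y # bs" "\<forall>a\<in>set as. \<not> P a" "P y" "zs = as @ f y # bs" by blast
    then show ?thesis using zs False
      by (intro exI[of _ "x # as"] exI[of _ y] exI[of _ bs]) auto
  qed
qed

lemma upd_first_NoneD: "upd_first P f xs = None \<Longrightarrow> x \<in> set xs \<Longrightarrow> \<not> P x"
  by (induction xs) (auto split: if_splits)

text \<open>The list of critical bins is split at the changed bin, so that an invariant has to be
  rechecked only there. An item of size at least \<open>xm\<close> reaches a t-bin only if all
  critical bins are occupied, as happens with ties at \<open>xm\<close>.\<close>

lemma dh_step_cases:
  assumes "1/2 \<le> xm"
  obtains (critical) as s bs where "xm \<le> v" "crit = as @ (None, s) # bs"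
      "dh_step xm (crit, tb, sb) v = (as @ (Some v, s) # bs, tb, sb)"
  | (tbin) "1/4 \<le> v" "xm \<le> v \<Longrightarrow> \<forall>c\<in>set crit. fst c \<noteq> None"
      "dh_step xm (crit, tb, sb) v = (crit, tb(tclass v := dnf_step (tb (tclass v)) v), sb)"
  | (fill) as w s bs where "v < 1/4" "crit = as @ (w, s) # bs"
      "\<forall>c\<in>set as. 1 \<le> vload xm c" "vload xm (w, s) < 1"
      "dh_step xm (crit, tb, sb) v = (as @ (w, s + v) # bs, tb, sb)"
  | (small) "v < 1/4" "\<forall>c\<in>set crit. 1 \<le> vload xm c"
      "dh_step xm (crit, tb, sb) v = (crit, tb, dnf_step sb v)"
proof (cases "if xm \<le> v then upd_first (\<lambda>c. fst c = None) (\<lambda>c. (Some v, snd c)) crit else None")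
  case (Some crit')
  then have "xm \<le> v" and u: "upd_first (\<lambda>c. fst c = None) (\<lambda>c. (Some v, snd c)) crit = Some crit'"
    by (auto split: if_splits)
  from upd_first_SomeD[OF u] obtain as x bs where
    "crit = as @ x # bs" "fst x = None" "crit' = as @ (Some v, snd x) # bs" by blast
  then show ?thesis using critical[of as "snd x" bs] \<open>xm \<le> v\<close> Some
    by (cases x) (simp add: dh_step_def)
next
  case None
  show ?thesis
  proof (cases "1/4 \<le> v")
    case True
    have "\<forall>c\<in>set crit. fst c \<noteq> None" if "xm \<le> v"
      using None that by (auto dest: upd_first_NoneD[where P = "\<lambda>c. fst c = None"])
    then show ?thesis using tbin True None by (simp add: dh_step_def)
  next
    case False
    show ?thesis
    proof (cases "upd_first (\<lambda>c. vload xm c < 1) (\<lambda>c. (fst c, snd c + v)) crit")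
      case None2: None
      have "\<forall>c\<in>set crit. 1 \<le> vload xm c"
        using upd_first_NoneD[OF None2] by (auto simp: not_less)
      then show ?thesis using small False None None2 by (simp add: dh_step_def)
    next
      case (Some crit')
      from upd_first_SomeD[OF Some] obtain as x bs where
        "crit = as @ x # bs" "\<forall>a\<in>set as. \<not> vload xm a < 1" "vload xm x < 1"
        "crit' = as @ (fst x, snd x + v) # bs" by blast
      then show ?thesis using fill[of as "fst x" "snd x" bs] False None Some
        by (cases x) (auto simp: dh_step_def not_less)
    qed
  qed
qed

text \<open>Induction along the prefixes of the input; the inclusion in \<open>set \<sigma>\<close>
  hands the validity of the items to each step.\<close>

lemma dh_run_induct [consumes 1, case_names Nil snoc]:
  assumes "dh_run m xm \<sigma> = (crit, tb, sb)"
    and "P [] (replicate m (None, 0)) (\<lambda>_. (0, 0)) (0, 0)"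
    and "\<And>\<sigma>' v crit tb sb crit' tb' sb'. set (\<sigma>' @ [v]) \<subseteq> set \<sigma> \<Longrightarrow> P \<sigma>' crit tb sb \<Longrightarrow>
      dh_step xm (crit, tb, sb) v = (crit', tb', sb') \<Longrightarrow> P (\<sigma>' @ [v]) crit' tb' sb'"
  shows "P \<sigma> crit tb sb"
proof -
  have "set \<sigma>' \<subseteq> set \<sigma> \<Longrightarrow> dh_run m xm \<sigma>' = (crit, tb, sb) \<Longrightarrow> P \<sigma>' crit tb sb" for \<sigma>' crit tb sb
  proof (induction \<sigma>' arbitrary: crit tb sb rule: rev_induct)
    case Nil
    then show ?case using assms(2) by (auto simp: dh_run_def)
  next
    case (snoc v \<sigma>')
    obtain c0 t0 s0 where run: "dh_run m xm \<sigma>' = (c0, t0, s0)" by (metis prod_cases3)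
    have "dh_step xm (c0, t0, s0) v = (crit, tb, sb)"
      using snoc.prems(2) run by (simp add: dh_run_def)
    then show ?case using snoc.IH[OF _ run] snoc.prems(1) assms(3) by simp
  qed
  then show ?thesis using assms(1) by blast
qed

text \<open>The upper bound holds because a bin receives small items only while its virtual load is
  below 1, hence while its small mass is below \<open>1 - xm\<close>, and the last of them adds less
  than 1/4.\<close>

definition cbin_ok :: "rat \<Rightarrow> cbin \<Rightarrow> bool" where
  "cbin_ok xm c \<longleftrightarrow> (\<forall>w. fst c = Some w \<longrightarrow> xm \<le> w) \<and> 0 \<le> snd c \<and> snd c \<le> 1 - xm + 1/4"

lemma snd_less_if_vload: "cbin_ok xm c \<Longrightarrow> vload xm c < 1 \<Longrightarrow> snd c < 1 - xm"
  by (fastforce simp: cbin_ok_def vload_def split: option.splits)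

lemma run_cbin_ok:
  assumes "dh_run m xm \<sigma> = (crit, tb, sb)" "valid_input \<sigma>" "1/2 \<le> xm" "xm \<le> 1"
  shows "length crit = m \<and> (\<forall>c\<in>set crit. cbin_ok xm c)"
  using assms(1)
proof (induction rule: dh_run_induct)
  case Nil
  then show ?case using assms by (auto simp: cbin_ok_def)
next
  case (snoc \<sigma>' v crit tb sb crit' tb' sb')
  have v: "0 < v" using snoc.hyps(1) assms(2) by (auto simp: valid_input_def)
  show ?case
    using assms(3)
  proof (cases rule: dh_step_cases[where v = v and crit = crit and tb = tb and sb = sb])
    case (critical as s bs)
    then show ?thesis using snoc by (auto simp: cbin_ok_def)
  next
    case tbin
    then show ?thesis using snoc by auto
  next
    case (fill as w s bs)
    then have "cbin_ok xm (w, s)" using snoc by simp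
    with snd_less_if_vload[OF this fill(4)] have "cbin_ok xm (w, s + v)"
      using fill v by (auto simp: cbin_ok_def)
    then show ?thesis using snoc fill by auto
  next
    case small
    then show ?thesis using snoc by auto
  qed
qed

text \<open>A bin never loses its item. If one is unoccupied now, one was at every earlier step, so
  each item of size at least \<open>xm\<close> went to a critical bin.\<close>

lemma run_occupied:
  assumes "dh_run m xm \<sigma> = (crit, tb, sb)" "1/2 \<le> xm"
  shows "(\<exists>c\<in>set crit. fst c = None) \<longrightarrow> occupied crit = length (filter (\<lambda>v. xm \<le> v) \<sigma>)"
  using assms(1)
proof (induction rule: dh_run_induct)
  case Nil
  then show ?case by (auto simp: occupied_def)
next
  case (snoc \<sigma>' v crit tb sb crit' tb' sb')
  show ?case
    using assms(2)
  proof (cases rule: dh_step_cases[where v = v and crit = crit and tb = tb and sb = sb])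
    case (critical as s bs)
    then show ?thesis using snoc by (auto simp: occupied_def)
  next
    case tbin
    then show ?thesis using snoc by auto
  next
    case (fill as w s bs)
    then have "\<not> xm \<le> v" using assms(2) by linarith
    then show ?thesis using snoc fill by (auto simp: occupied_def)
  next
    case small
    then have "\<not> xm \<le> v" using assms(2) by linarith
    then show ?thesis using snoc small by auto
  qed
qed

lemma occupied_eq_all:
  assumes "\<forall>c\<in>set crit. fst c \<noteq> None"
  shows "occupied crit = length crit"
proof -
  have "filter (\<lambda>c. fst c \<noteq> None) crit = crit" using assms by (simp add: filter_id_conv)
  then show ?thesis by (simp add: occupied_def)
qed

lemma run_all_occupied:
  assumes "dh_run m xm \<sigma> = (crit, tb, sb)" "valid_input \<sigma>" "1/2 \<le> xm" "xm \<le> 1"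
    and "m \<le> length (filter (\<lambda>v. xm \<le> v) \<sigma>)"
  shows "\<forall>c\<in>set crit. fst c \<noteq> None"
proof (rule ccontr)
  assume n: "\<not> ?thesis"
  then have "occupied crit = length (filter (\<lambda>v. xm \<le> v) \<sigma>)"
    using run_occupied[OF assms(1,3)] by auto
  moreover have "occupied crit < length crit"
    unfolding occupied_def using n by (auto intro: length_filter_less)
  ultimately show False using assms(5) run_cbin_ok[OF assms(1-4)] by simp
qed

text \<open>Here \<open>j\<close> is the number of items in the active bin, \<open>N\<close> the number of items placed so far.\<close>

definition dnf_count_inv :: "nat \<Rightarrow> nat \<Rightarrow> rat \<times> nat \<Rightarrow> bool" where
  "dnf_count_inv t N lc \<longleftrightarrow>
     (\<exists>j. N \<le> t * snd lc + j \<and> of_nat j \<le> of_nat t * fst lc \<and> fst lc < 1)"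

lemma dnf_count_inv_step:
  assumes "dnf_count_inv t N lc" "1 / of_nat t \<le> v" "t > 0"
  shows "dnf_count_inv t (Suc N) (dnf_step lc v)"
proof -
  obtain j where j: "N \<le> t * snd lc + j" "of_nat j \<le> of_nat t * fst lc" "fst lc < 1"
    using assms(1) by (auto simp: dnf_count_inv_def)
  have tv: "1 \<le> of_nat t * v" using assms(2,3) by (simp add: field_simps)
  \<comment> \<open>An uncovered bin holds fewer than \<open>t\<close> items of size at least
    \<open>1/t\<close>, so a bin that closes now accounts for at most \<open>t\<close>
    items.\<close>
  have "of_nat t * fst lc < of_nat t" using j(3) assms(3) by simp
  then have "(of_nat j :: rat) < of_nat t" using j(2) by linarith
  then have "j < t" by simp
  then have "Suc N \<le> t * Suc (snd lc) + 0" using j(1) by simp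
  moreover have "of_nat (Suc j) \<le> of_nat t * (fst lc + v)"
    using j(2) tv by (simp add: algebra_simps)
  moreover have "Suc N \<le> t * snd lc + Suc j" using j(1) by simp
  ultimately show ?thesis
    unfolding dnf_count_inv_def dnf_step_def
    by (cases "1 \<le> fst lc + v") (rule exI[of _ 0], simp, rule exI[of _ "Suc j"], simp)
qed

lemma dnf_count_inv_bound:
  assumes "dnf_count_inv t N lc"
  shows "N \<le> t * snd lc + (t - 1)"
proof -
  obtain j where j: "N \<le> t * snd lc + j" "of_nat j \<le> of_nat t * fst lc" "fst lc < 1"
    using assms by (auto simp: dnf_count_inv_def)
  show ?thesis
  proof (cases "t = 0")
    case False
    then have "of_nat t * fst lc < of_nat t" using j(3) by simp
    then have "(of_nat j :: rat) < of_nat t" using j(2) by linarith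
    then show ?thesis using j(1) by simp
  qed (use j in simp)
qed

lemma tclass_bounds: "1/4 \<le> v \<Longrightarrow> 1 / of_nat (tclass v) \<le> v" "tclass v \<in> {2,3,4}"
  by (auto simp: tclass_def)

text \<open>Since \<open>1/2 \<le> xm\<close>, the occupying items of critical bins are 2-items;
  \<open>N\<close> counts the other 2-items, which went to the 2-bin.\<close>

lemma run_class_counts:
  assumes "dh_run m xm \<sigma> = (crit, tb, sb)" "1/2 \<le> xm"
  shows "(\<exists>N. class_count 2 \<sigma> = occupied crit + N \<and> dnf_count_inv 2 N (tb 2)) \<and>
    dnf_count_inv 3 (class_count 3 \<sigma>) (tb 3) \<and> dnf_count_inv 4 (class_count 4 \<sigma>) (tb 4)"
  using assms(1)
proof (induction rule: dh_run_induct)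
  case Nil
  then show ?case by (auto simp: class_count_def occupied_def dnf_count_inv_def)
next
  case (snoc \<sigma>' v crit tb sb crit' tb' sb')
  show ?case
    using assms(2)
  proof (cases rule: dh_step_cases[where v = v and crit = crit and tb = tb and sb = sb])
    case (critical as s bs)
    then have "tclass v = 2" "1/4 \<le> v" using assms(2) by (auto simp: tclass_def)
    then show ?thesis using snoc critical by (auto simp: class_count_def occupied_def)
  next
    case tbin
    obtain N where N: "class_count 2 \<sigma>' = occupied crit + N" "dnf_count_inv 2 N (tb 2)"
      using snoc by auto
    have step: "dnf_count_inv (tclass v) (Suc K) (dnf_step (tb (tclass v)) v)"
      if "dnf_count_inv (tclass v) K (tb (tclass v))" for K
      using dnf_count_inv_step[OF that tclass_bounds(1)[OF tbin(1)]] tclass_bounds(2)[of v] by auto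
    have cnt: "class_count t (\<sigma>' @ [v]) = class_count t \<sigma>' + (if tclass v = t then 1 else 0)" for t
      using tbin(1) by (auto simp: class_count_def)
    have eqs: "crit' = crit" "tb' = tb(tclass v := dnf_step (tb (tclass v)) v)"
      using snoc.hyps(2) tbin(3) by auto
    consider "tclass v = 2" | "tclass v = 3" | "tclass v = 4" using tclass_bounds(2)[of v] by auto
    then show ?thesis
    proof cases
      case 1
      then have "dnf_count_inv 2 (Suc N) (dnf_step (tb 2) v)" using step N(2) by simp
      then show ?thesis using 1 snoc.IH N(1) by (auto simp: eqs cnt)
    next
      case 2
      then show ?thesis using step[of "class_count 3 \<sigma>'"] snoc.IH by (auto simp: eqs cnt)
    next
      case 3
      then show ?thesis using step[of "class_count 4 \<sigma>'"] snoc.IH by (auto simp: eqs cnt)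
    qed
  next
    case (fill as w s bs)
    then show ?thesis using snoc by (auto simp: class_count_def occupied_def)
  next
    case small
    then show ?thesis using snoc by (auto simp: class_count_def)
  qed
qed

text \<open>\<open>R\<close> is the mass sent to small bins. A closed one took less than 1 + 1/4,
  because its last item is below 1/4.\<close>

lemma run_small_mass:
  assumes "dh_run m xm \<sigma> = (crit, tb, sb)" "valid_input \<sigma>" "1/2 \<le> xm"
  shows "\<exists>R\<ge>0. sum_list (map small_part \<sigma>) = sum_list (map snd crit) + R \<and>
    R \<le> 5/4 * of_nat (snd sb) + fst sb \<and> fst sb < 1"
  using assms(1)
proof (induction rule: dh_run_induct)
  case Nil
  then show ?case by (auto simp: sum_list_replicate)
next
  case (snoc \<sigma>' v crit tb sb crit' tb' sb')
  have v: "0 < v" using snoc.hyps(1) assms(2) by (auto simp: valid_input_def)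
  obtain R where R: "R \<ge> 0" "sum_list (map small_part \<sigma>') = sum_list (map snd crit) + R"
    "R \<le> 5/4 * of_nat (snd sb) + fst sb" "fst sb < 1" using snoc.IH by blast
  show ?case
    using assms(3)
  proof (cases rule: dh_step_cases[where v = v and crit = crit and tb = tb and sb = sb])
    case (critical as s bs)
    then have "small_part v = 0" using assms(3) by (auto simp: small_part_def)
    then show ?thesis using snoc critical by auto
  next
    case tbin
    then have "small_part v = 0" by (auto simp: small_part_def)
    then show ?thesis using snoc tbin by auto
  next
    case (fill as w s bs)
    then have "small_part v = v" by (auto simp: small_part_def)
    then show ?thesis using snoc fill by auto
  next
    case small
    then have "small_part v = v" by (auto simp: small_part_def)
    moreover have "R + v \<le> 5/4 * of_nat (snd (dnf_step sb v)) + fst (dnf_step sb v)"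
      "fst (dnf_step sb v) < 1"
      using R small(1) by (auto simp: dnf_step_def algebra_simps)
    ultimately show ?thesis using snoc.hyps(2) small R(1,2) v
      by (intro exI[of _ "R + v"]) auto
  qed
qed

text \<open>If every critical bin reaches virtual load 1, then all of them end up covered, and only the
  small items spent on them (\<open>K\<close> below) are missing from the small bins.\<close>

lemma covered_if_filled:
  assumes run: "dh_run m xm \<sigma> = (crit, tb, sb)" and "valid_input \<sigma>" "1/2 \<le> xm" "xm \<le> 1"
    and "m \<le> length (filter (\<lambda>v. xm \<le> v) \<sigma>)" and full: "\<forall>c\<in>set crit. 1 \<le> vload xm c"
  obtains K where "K \<le> sum_list (map small_part \<sigma>)" "K \<le> of_nat m * (5/4 - xm)"
    "rat_of_nat (dh_covered (dh_run m xm \<sigma>)) \<ge> of_nat m + (of_nat (class_count 2 \<sigma>) - of_nat m - 1) / 2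
       + (of_nat (class_count 3 \<sigma>) - 2) / 3 + (of_nat (class_count 4 \<sigma>) - 3) / 4
       + 4/5 * (sum_list (map small_part \<sigma>) - K - 1)"
proof -
  define K where "K = sum_list (map snd crit)"
  have ok: "length crit = m" "\<forall>c\<in>set crit. cbin_ok xm c" using run_cbin_ok[OF assms(1-4)] by auto
  have occ: "\<forall>c\<in>set crit. fst c \<noteq> None" using run_all_occupied[OF assms(1-5)] .
  then have occm: "occupied crit = m" using ok(1) occupied_eq_all by metis
  have "1 \<le> aload c" if "c \<in> set crit" for c
    using occ full that by (auto simp: vload_def aload_def split: option.splits)
  then have "filter (\<lambda>c. 1 \<le> aload c) crit = crit" by (simp add: filter_id_conv)
  then have cov: "dh_covered (dh_run m xm \<sigma>) = m + snd (tb 2) + snd (tb 3) + snd (tb 4) + snd sb"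
    using ok(1) by (simp add: run dh_covered_def)
  obtain N where N: "class_count 2 \<sigma> = m + N" "dnf_count_inv 2 N (tb 2)"
    and c3: "dnf_count_inv 3 (class_count 3 \<sigma>) (tb 3)" and c4: "dnf_count_inv 4 (class_count 4 \<sigma>) (tb 4)"
    using run_class_counts[OF run assms(3)] occm by auto
  \<comment> \<open>An active t-bin holds at most \<open>t - 1\<close> items, which is the loss in
    each class.\<close>
  have b2: "class_count 2 \<sigma> \<le> m + 2 * snd (tb 2) + 1" using dnf_count_inv_bound[OF N(2)] N(1) by simp
  have b3: "class_count 3 \<sigma> \<le> 3 * snd (tb 3) + 2" using dnf_count_inv_bound[OF c3] by simp
  have b4: "class_count 4 \<sigma> \<le> 4 * snd (tb 4) + 3" using dnf_count_inv_bound[OF c4] by simp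
  have "rat_of_nat (class_count 2 \<sigma>) \<le> of_nat (m + 2 * snd (tb 2) + 1)"
    "rat_of_nat (class_count 3 \<sigma>) \<le> of_nat (3 * snd (tb 3) + 2)"
    "rat_of_nat (class_count 4 \<sigma>) \<le> of_nat (4 * snd (tb 4) + 3)"
    using b2 b3 b4 of_nat_mono by blast+
  then have r: "rat_of_nat (class_count 2 \<sigma>) \<le> of_nat m + 2 * of_nat (snd (tb 2)) + 1"
    "rat_of_nat (class_count 3 \<sigma>) \<le> 3 * of_nat (snd (tb 3)) + 2"
    "rat_of_nat (class_count 4 \<sigma>) \<le> 4 * of_nat (snd (tb 4)) + 3" by simp_all
  obtain R where R: "R \<ge> 0" "sum_list (map small_part \<sigma>) = K + R"
    "R \<le> 5/4 * of_nat (snd sb) + fst sb" "fst sb < 1"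
    using run_small_mass[OF assms(1-3)] unfolding K_def by auto
  have "snd c \<le> 5/4 - xm" if "c \<in> set crit" for c using ok(2) that by (auto simp: cbin_ok_def)
  then have "K \<le> sum_list (map (\<lambda>_. 5/4 - xm) crit)"
    unfolding K_def by (rule sum_list_mono)
  then have "K \<le> of_nat m * (5/4 - xm)" using ok(1) by (simp add: sum_list_triv)
  \<comment> \<open>The factor 4/5 inverts the load bound 5/4 of a closed small bin, and the active
    one wastes less than 1.\<close>
  moreover have "rat_of_nat (dh_covered (dh_run m xm \<sigma>)) \<ge>
       of_nat m + (of_nat (class_count 2 \<sigma>) - of_nat m - 1) / 2
       + (of_nat (class_count 3 \<sigma>) - 2) / 3 + (of_nat (class_count 4 \<sigma>) - 3) / 4
       + 4/5 * (sum_list (map small_part \<sigma>) - K - 1)"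
    using r R unfolding cov by (simp add: field_simps)
  moreover have "K \<le> sum_list (map small_part \<sigma>)" using R by simp
  ultimately show ?thesis using that by blast
qed

text \<open>Small items only enter the first unfilled critical bin. Counting a small item with at most
  \<open>1 - xm\<close>, a filled critical bin absorbs at most \<open>2 * (1 - xm)\<close>.\<close>

definition fill_bound :: "rat \<Rightarrow> cbin \<Rightarrow> rat" where
  "fill_bound xm c = (if vload xm c < 1 then snd c else 2 * (1 - xm))"

text \<open>Virtual loads never decrease, so a critical bin that is unfilled now was unfilled
  throughout, and no small item has reached the small bin. The sortedness says that bins behind the
  first unfilled one hold no small items.\<close>

lemma run_truncated_mass:
  assumes "dh_run m xm \<sigma> = (crit, tb, sb)" "valid_input \<sigma>" "1/2 \<le> xm" "xm \<le> 1"
  shows "(\<forall>c\<in>set crit. cbin_ok xm c) \<and>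
    sorted_wrt (\<lambda>c d. vload xm c < 1 \<longrightarrow> snd d = 0) crit \<and>
    ((\<exists>c\<in>set crit. vload xm c < 1) \<longrightarrow>
      sum_list (map (\<lambda>v. min (small_part v) (1 - xm)) \<sigma>) \<le> sum_list (map (fill_bound xm) crit))"
  using assms(1)
proof (induction rule: dh_run_induct)
  case Nil
  then show ?case using assms
    by (auto simp: fill_bound_def sorted_wrt_iff_nth_less sum_list_replicate vload_def cbin_ok_def)
next
  case (snoc \<sigma>' v crit tb sb crit' tb' sb')
  let ?T = "\<lambda>s. sum_list (map (\<lambda>v. min (small_part v) (1 - xm)) s)"
  have v: "0 < v" using snoc.hyps(1) assms(2) by (auto simp: valid_input_def)
  show ?case
    using assms(3)
  proof (cases rule: dh_step_cases[where v = v and crit = crit and tb = tb and sb = sb])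
    case (critical as s bs)
    have ok: "cbin_ok xm (None, s)" using snoc critical by auto
    have "small_part v = 0" using assms(3) critical by (auto simp: small_part_def)
    then have T: "?T (\<sigma>' @ [v]) = ?T \<sigma>'" using assms(4) by simp
    \<comment> \<open>The actual item may raise the virtual load to 1; the bound of the bin then
      jumps from \<open>s < 1 - xm\<close> to \<open>2 * (1 - xm)\<close>.\<close>
    have "vload xm (None, s) \<le> vload xm (Some v, s)" using critical by (simp add: vload_def)
    moreover have "fill_bound xm (None, s) \<le> fill_bound xm (Some v, s)"
      using snd_less_if_vload[OF ok] calculation assms(4) by (auto simp: fill_bound_def)
    moreover have "cbin_ok xm (Some v, s)" using ok critical by (auto simp: cbin_ok_def)
    ultimately show ?thesis using snoc critical T by (auto simp: sorted_wrt_append)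
  next
    case tbin
    then have "small_part v = 0" by (auto simp: small_part_def)
    then show ?thesis using snoc tbin assms(4) by auto
  next
    case (fill as w s bs)
    have ok: "cbin_ok xm (w, s)" using snoc fill by auto
    have s: "s < 1 - xm" using snd_less_if_vload[OF ok fill(4)] by simp
    have "small_part v = v" using fill by (auto simp: small_part_def)
    then have "?T (\<sigma>' @ [v]) = ?T \<sigma>' + min v (1 - xm)" by simp
    \<comment> \<open>A bin that stays unfilled gains all of \<open>v\<close>. One that becomes
      filled had less than \<open>1 - xm\<close>, and the truncated item adds at most
      \<open>1 - xm\<close>.\<close>
    moreover have "fill_bound xm (w, s) + min v (1 - xm) \<le> fill_bound xm (w, s + v)"
      using s fill(4) by (auto simp: fill_bound_def)
    moreover have "?T \<sigma>' \<le> sum_list (map (fill_bound xm) crit)" using snoc.IH fill by auto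
    moreover have "cbin_ok xm (w, s + v)" using ok s v fill(1) by (auto simp: cbin_ok_def)
    moreover have "\<forall>c\<in>set bs. snd c = 0" using snoc.IH fill by (auto simp: sorted_wrt_append)
    ultimately show ?thesis using snoc fill by (auto simp: sorted_wrt_append)
  next
    case small
    then show ?thesis using snoc by auto
  qed
qed

text \<open>The first unfilled bin contributes less than \<open>1 - xm\<close>, each of the other
  \<open>m - 1\<close> bins at most twice that.\<close>

lemma truncated_mass_less_if_unfilled:
  assumes "dh_run m xm \<sigma> = (crit, tb, sb)" "valid_input \<sigma>" "1/2 \<le> xm" "xm < 1"
    and "c \<in> set crit" "vload xm c < 1"
  shows "sum_list (map (\<lambda>v. min (small_part v) (1 - xm)) \<sigma>) < (2 * of_nat m - 1) * (1 - xm)"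
proof -
  have xm: "xm \<le> 1" using assms(4) by simp
  obtain as d bs where split: "crit = as @ d # bs" "vload xm d < 1" "\<forall>a\<in>set as. \<not> vload xm a < 1"
    using split_list_first_prop[of crit "\<lambda>c. vload xm c < 1"] assms(5,6) by blast
  have inv: "\<forall>c\<in>set crit. cbin_ok xm c" "sorted_wrt (\<lambda>c d. vload xm c < 1 \<longrightarrow> snd d = 0) crit"
    "sum_list (map (\<lambda>v. min (small_part v) (1 - xm)) \<sigma>) \<le> sum_list (map (fill_bound xm) crit)"
    using run_truncated_mass[OF assms(1-3) xm] assms(5,6) by auto
  have d: "fill_bound xm d < 1 - xm"
    using snd_less_if_vload[of xm d] inv(1) split by (auto simp: fill_bound_def)
  have "sum_list (map (fill_bound xm) as) \<le> sum_list (map (\<lambda>_. 2 * (1 - xm)) as)"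
    by (rule sum_list_mono) (use split in \<open>auto simp: fill_bound_def\<close>)
  moreover have "sum_list (map (fill_bound xm) bs) \<le> sum_list (map (\<lambda>_. 2 * (1 - xm)) bs)"
    by (rule sum_list_mono)
      (use split inv(2) assms(4) in \<open>auto simp: fill_bound_def sorted_wrt_append\<close>)
  moreover have "m = length as + length bs + 1"
    using run_cbin_ok[OF assms(1-3) xm] split by auto
  ultimately show ?thesis using inv(3) d split(1) by (simp add: sum_list_triv algebra_simps)
qed

section \<open>The \<open>m\<close>-th largest item\<close>

text \<open>In decreasing order the first \<open>m\<close> entries are at least \<open>x_m\<close>,
  and only the first \<open>m - 1\<close> can exceed it. Ties make both counts inequalities.\<close>

lemma nth_largest:
  assumes "1 \<le> m" "m \<le> length \<sigma>"
  shows "xm_of \<sigma> m \<in> set \<sigma>" "m \<le> length (filter (\<lambda>v. xm_of \<sigma> m \<le> v) \<sigma>)"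
    "length (filter (\<lambda>v. xm_of \<sigma> m < v) \<sigma>) \<le> m - 1"
proof -
  define L where "L = rev (sort \<sigma>)"
  have L: "sorted_wrt (\<ge>) L" "mset L = mset \<sigma>" "length L = length \<sigma>" "set L = set \<sigma>"
    by (simp_all add: L_def sorted_wrt_rev)
  have x: "xm_of \<sigma> m = L ! (m - 1)" using assms by (simp add: xm_of_def L_def)
  have same: "length (filter P \<sigma>) = length (filter P L)" for P
    using L(2) by (metis mset_filter size_mset)
  have lt: "m - 1 < length L" using assms L(3) by simp
  then show "xm_of \<sigma> m \<in> set \<sigma>" using x L(4) nth_mem by metis
  have mono: "L ! j \<le> L ! i" if "i \<le> j" "j < length L" for i j
    using L(1) that by (cases "i = j") (auto simp: sorted_wrt_iff_nth_less)
  have "\<forall>v\<in>set (take m L). xm_of \<sigma> m \<le> v"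
    using mono lt assms(1) by (auto simp: x in_set_conv_nth)
  then have f: "filter (\<lambda>v. xm_of \<sigma> m \<le> v) (take m L) = take m L" by (simp add: filter_id_conv)
  have "filter (\<lambda>v. xm_of \<sigma> m \<le> v) L = take m L @ filter (\<lambda>v. xm_of \<sigma> m \<le> v) (drop m L)"
    using f by (metis append_take_drop_id filter_append)
  then show "m \<le> length (filter (\<lambda>v. xm_of \<sigma> m \<le> v) \<sigma>)"
    using assms L(3) by (simp add: same)
  have "\<forall>v\<in>set (drop (m - 1) L). \<not> xm_of \<sigma> m < v"
    using mono by (auto simp: x in_set_conv_nth not_less)
  then have g: "filter (\<lambda>v. xm_of \<sigma> m < v) (drop (m - 1) L) = []" by (simp add: filter_empty_conv)
  have "filter (\<lambda>v. xm_of \<sigma> m < v) L = filter (\<lambda>v. xm_of \<sigma> m < v) (take (m - 1) L)"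
    using g by (metis append_take_drop_id filter_append append_Nil2)
  then show "length (filter (\<lambda>v. xm_of \<sigma> m < v) \<sigma>) \<le> m - 1"
    using length_filter_le[of "\<lambda>v. xm_of \<sigma> m < v" "take (m - 1) L"] by (simp add: same)
qed

section \<open>Weights\<close>

definition weight :: "rat \<Rightarrow> rat" where
  "weight v = (if 1/4 \<le> v then 1 / of_nat (tclass v) else 2/3 * v)"

lemma sum_list_weight:
  "sum_list (map weight \<sigma>) = of_nat (class_count 2 \<sigma>) / 2 + of_nat (class_count 3 \<sigma>) / 3
     + of_nat (class_count 4 \<sigma>) / 4 + 2/3 * sum_list (map small_part \<sigma>)"
  by (induction \<sigma>) (auto simp: weight_def class_count_def small_part_def tclass_def field_simps)

text \<open>Items below 1/2 weigh at least 2/3 of their size, so a light covered bin needs a 2-item.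
  Any further non-small item would bring the weight to at least 1/2 + 1/4 > 2/3; so the rest is
  small, and its weight is below 2/3 - 1/2 = 1/6.\<close>

lemma light_covered_bin:
  assumes "finite B" "\<And>i. i \<in> B \<Longrightarrow> 0 < f i \<and> f i < 1"
    and "1 \<le> sum f B" "(\<Sum>i\<in>B. weight (f i)) < 2/3"
  obtains i where "i \<in> B" "1 - f i \<le> (\<Sum>i\<in>B. small_part (f i))" "(\<Sum>i\<in>B. small_part (f i)) < 1/4"
    "(\<Sum>i\<in>B. weight (f i)) = 1/2 + 2/3 * (\<Sum>i\<in>B. small_part (f i))"
proof -
  have nonneg: "0 \<le> weight (f i)" if "i \<in> B" for i
    using assms(2)[OF that] by (simp add: weight_def)
  have "\<exists>i\<in>B. 1/2 \<le> f i"
  proof (rule ccontr)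
    assume "\<not> ?thesis"
    then have "2/3 * f i \<le> weight (f i)" if "i \<in> B" for i
      using that by (auto simp: weight_def tclass_def)
    then have "(\<Sum>i\<in>B. 2/3 * f i) \<le> (\<Sum>i\<in>B. weight (f i))" by (rule sum_mono)
    then have "2/3 * sum f B \<le> (\<Sum>i\<in>B. weight (f i))" by (simp only: sum_distrib_left)
    then show False using assms(3,4) by simp
  qed
  then obtain i where i: "i \<in> B" "1/2 \<le> f i" by blast
  have wi: "weight (f i) = 1/2" "small_part (f i) = 0"
    using i by (auto simp: weight_def tclass_def small_part_def)
  have split: "sum h B = h i + sum h (B - {i})" for h :: "_ \<Rightarrow> rat"
    using assms(1) i(1) by (simp add: sum.remove)
  have small: "f j < 1/4" if j: "j \<in> B - {i}" for j
  proof (rule ccontr)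
    assume "\<not> f j < 1/4"
    then have "1/4 \<le> weight (f j)" by (auto simp: weight_def tclass_def)
    also have "\<dots> \<le> (\<Sum>i\<in>B - {i}. weight (f i))"
      using j assms(1) nonneg by (intro member_le_sum) auto
    finally show False using split[of "\<lambda>i. weight (f i)"] wi assms(4) by linarith
  qed
  have "(\<Sum>j\<in>B - {i}. weight (f j)) = (\<Sum>j\<in>B - {i}. 2/3 * small_part (f j))"
    by (intro sum.cong refl) (use small in \<open>fastforce simp: weight_def small_part_def\<close>)
  then have w: "(\<Sum>j\<in>B. weight (f j)) = 1/2 + 2/3 * (\<Sum>j\<in>B. small_part (f j))"
    using wi split[of "\<lambda>i. weight (f i)"] split[of "\<lambda>i. small_part (f i)"]
    by (simp add: sum_distrib_left)
  have "sum f (B - {i}) = (\<Sum>j\<in>B - {i}. small_part (f j))"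
    by (intro sum.cong refl) (use small in \<open>auto simp: small_part_def\<close>)
  then have "1 - f i \<le> (\<Sum>j\<in>B. small_part (f j))"
    using wi split[of f] split[of "\<lambda>i. small_part (f i)"] assms(3) by simp
  moreover have "(\<Sum>j\<in>B. small_part (f j)) < 1/4" using w assms(4) by simp
  ultimately show ?thesis using that i(1) w by blast
qed

text \<open>Either one term alone reaches \<open>d\<close>, or truncation changes nothing.\<close>

lemma sum_min_ge:
  fixes f :: "'a \<Rightarrow> rat"
  assumes "finite B" "\<And>i. i \<in> B \<Longrightarrow> 0 \<le> f i" "0 \<le> d" "d \<le> sum f B"
  shows "d \<le> (\<Sum>i\<in>B. min (f i) d)"
proof (cases "\<exists>i\<in>B. d \<le> f i")
  case True
  then obtain i where i: "i \<in> B" "d \<le> f i" by blast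
  then have "min (f i) d \<le> (\<Sum>i\<in>B. min (f i) d)"
    using assms by (intro member_le_sum) auto
  then show ?thesis using i by simp
next
  case False
  then have "(\<Sum>i\<in>B. min (f i) d) = sum f B" by (intro sum.cong) auto
  then show ?thesis using assms by simp
qed

text \<open>The bins of a packing are the disjoint fibres of its assignment \<open>g\<close>;
  \<open>A\<close> selects some of them.\<close>

lemma sum_fibres_le:
  fixes q :: "'a \<Rightarrow> rat"
  assumes "finite I" "finite A" "\<And>i. i \<in> I \<Longrightarrow> 0 \<le> q i"
  shows "(\<Sum>j\<in>A. \<Sum>i\<in>{i\<in>I. g i = j}. q i) \<le> sum q I"
proof -
  have "(\<Sum>j\<in>A. \<Sum>i\<in>{i\<in>I. g i = j}. q i)
      = (\<Sum>j\<in>A. \<Sum>i\<in>{i\<in>{i\<in>I. g i \<in> A}. g i = j}. q i)"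
    by (intro sum.cong refl) auto
  also have "\<dots> = sum q {i\<in>I. g i \<in> A}"
    using assms by (intro sum.group) auto
  also have "\<dots> \<le> sum q I" using assms by (intro sum_mono2) auto
  finally show ?thesis .
qed

lemma sum_list_map_conv_sum: "sum_list (map f xs) = (\<Sum>i<length xs. f (xs ! i))"
  by (simp add: sum_list_sum_nth atLeast0LessThan)

text \<open>Used with feasibility for \<open>P\<close> and half the number of light bins for
  \<open>K\<close>, this yields the two cases of the main argument.\<close>

lemma last_before_failure:
  assumes "P 0"
  obtains M where "M \<le> K" "P M" "M = K \<or> \<not> P (Suc M)"
proof -
  have "\<exists>M\<le>K. P M \<and> (M = K \<or> \<not> P (Suc M))"
  proof (induction K)
    case (Suc K)
    then show ?case by (metis le_Suc_eq order_refl)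
  qed (use assms in simp)
  then show ?thesis using that by blast
qed

section \<open>A good number of critical bins\<close>

text \<open>A covered bin is nonempty, so its index lies in the image of \<open>g\<close>. This
  makes the cardinality in \<open>covered_bins\<close> and the maximum in \<open>OPT\<close>
  genuine.\<close>

lemma covered_bins_finite:
  "finite {j. 1 \<le> (\<Sum>i\<in>{i. i < length \<sigma> \<and> g i = j}. \<sigma> ! i)}"
  "covered_bins \<sigma> g \<le> length \<sigma>"
proof -
  let ?J = "{j. 1 \<le> (\<Sum>i\<in>{i. i < length \<sigma> \<and> g i = j}. \<sigma> ! i)}"
  have sub: "?J \<subseteq> g ` {..<length \<sigma>}"
  proof
    fix j assume j: "j \<in> ?J"
    have "{i. i < length \<sigma> \<and> g i = j} \<noteq> {}"
    proof
      assume "{i. i < length \<sigma> \<and> g i = j} = {}"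
      with j show False by (simp only: mem_Collect_eq) simp
    qed
    then show "j \<in> g ` {..<length \<sigma>}" by auto
  qed
  then show "finite ?J" by (rule finite_subset) simp
  have "card ?J \<le> card (g ` {..<length \<sigma>})" using sub by (intro card_mono) auto
  also have "\<dots> \<le> length \<sigma>" using card_image_le[of "{..<length \<sigma>}" g] by simp
  finally show "covered_bins \<sigma> g \<le> length \<sigma>" by (simp add: covered_bins_def)
qed

lemma n2_le_length: "n2 \<sigma> \<le> length \<sigma>"
  by (simp add: n2_def)

lemma OPT_attained: obtains g where "OPT \<sigma> = covered_bins \<sigma> g"
proof -
  have "finite {covered_bins \<sigma> g | g. True}"
    by (rule finite_subset[of _ "{..length \<sigma>}"]) (use covered_bins_finite(2) in auto)
  then have "OPT \<sigma> \<in> {covered_bins \<sigma> g | g. True}"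
    unfolding OPT_def by (rule Max_in) auto
  then show ?thesis using that by blast
qed

lemma good_m_exists:
  assumes valid: "valid_input \<sigma>"
  shows "\<exists>m\<le>n2 \<sigma>. rat_of_nat (dh_covered (dh_run m (xm_of \<sigma> m) \<sigma>)) \<ge> 2/3 * of_nat (OPT \<sigma>) - 173/60"
proof -

  \<comment> \<open>An optimal packing and its light bins\<close>
  obtain g where g: "OPT \<sigma> = covered_bins \<sigma> g" by (rule OPT_attained)
  define n where "n = length \<sigma>"
  define B where "B j = {i\<in>{..<n}. g i = j}" for j
  define J where "J = {j. 1 \<le> (\<Sum>i\<in>B j. \<sigma> ! i)}"
  define s where "s j = (\<Sum>i\<in>B j. small_part (\<sigma> ! i))" for j
  define A where "A = {j\<in>J. (\<Sum>i\<in>B j. weight (\<sigma> ! i)) < 2/3}"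
  define a where "a = card A"
  define S where "S = sum_list (map small_part \<sigma>)"
  define SA where "SA = (\<Sum>j\<in>A. s j)"
  have B: "B j = {i. i < length \<sigma> \<and> g i = j}" for j by (auto simp: B_def n_def)
  have finB: "finite (B j)" for j by (simp add: B_def)
  have finJ: "finite J" unfolding J_def B by (rule covered_bins_finite(1))
  have optJ: "OPT \<sigma> = card J" by (simp add: g covered_bins_def J_def B)
  have AJ: "A \<subseteq> J" by (auto simp: A_def)
  have finA: "finite A" using AJ finJ by (rule finite_subset)
  have item: "0 < \<sigma> ! i" "\<sigma> ! i < 1" if "i < n" for i
    using valid that by (auto simp: valid_input_def n_def)
  have sp: "0 \<le> small_part (\<sigma> ! i)" "small_part (\<sigma> ! i) \<le> 1/4" "0 \<le> weight (\<sigma> ! i)" if "i < n" for i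
    using item[OF that] by (auto simp: small_part_def weight_def)
  \<comment> \<open>\<open>y j\<close> will be the position of the 2-item in the light bin
    \<open>j\<close>.\<close>
  have "\<exists>i. i \<in> B j \<and> 1 - \<sigma> ! i \<le> s j \<and> s j < 1/4 \<and> (\<Sum>i\<in>B j. weight (\<sigma> ! i)) = 1/2 + 2/3 * s j"
    if "j \<in> A" for j
    by (rule light_covered_bin[OF finB, of j "\<lambda>i. \<sigma> ! i"])
      (use that item in \<open>auto simp: A_def J_def B_def s_def\<close>)
  then obtain y where y: "\<And>j. j \<in> A \<Longrightarrow> y j \<in> B j \<and> 1 - \<sigma> ! y j \<le> s j \<and> s j < 1/4 \<and>
      (\<Sum>i\<in>B j. weight (\<sigma> ! i)) = 1/2 + 2/3 * s j"
    by metis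
  have yn: "y j < n" "g (y j) = j" "3/4 < \<sigma> ! y j" if "j \<in> A" for j
    using y[OF that] by (auto simp: B_def)
  have inj: "inj_on y A" by (rule inj_onI) (metis yn(2))
  have s0: "0 \<le> s j" for j unfolding s_def by (rule sum_nonneg) (use sp in \<open>auto simp: B_def\<close>)

  \<comment> \<open>Other covered bins weigh at least 2/3, light ones exactly
    \<open>1/2 + 2/3 * s j\<close>; so the weight falls short of 2/3 per bin by at most
    \<open>a/6 - 2/3 * SA\<close>.\<close>
  have "2/3 * of_nat (card J - a) + (of_nat a / 2 + 2/3 * SA) \<le> (\<Sum>j\<in>J - A. 2/3) + (\<Sum>j\<in>A. 1/2 + 2/3 * s j)"
    using finA finJ AJ by (simp add: a_def SA_def sum.distrib sum_distrib_left card_Diff_subset)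
  also have "\<dots> \<le> (\<Sum>j\<in>J - A. \<Sum>i\<in>B j. weight (\<sigma> ! i)) + (\<Sum>j\<in>A. \<Sum>i\<in>B j. weight (\<sigma> ! i))"
  proof (intro add_mono sum_mono)
    show "2/3 \<le> (\<Sum>i\<in>B j. weight (\<sigma> ! i))" if "j \<in> J - A" for j
      using that by (simp add: A_def not_less)
    show "1/2 + 2/3 * s j \<le> (\<Sum>i\<in>B j. weight (\<sigma> ! i))" if "j \<in> A" for j
      using y[OF that] by linarith
  qed
  also have "\<dots> = (\<Sum>j\<in>J. \<Sum>i\<in>B j. weight (\<sigma> ! i))"
    by (rule sum.subset_diff[OF AJ finJ, symmetric])
  also have "\<dots> \<le> (\<Sum>i<n. weight (\<sigma> ! i))"
    unfolding B_def by (rule sum_fibres_le) (use finJ sp in auto)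
  also have "\<dots> = sum_list (map weight \<sigma>)" by (simp add: sum_list_map_conv_sum n_def)
  finally have "2/3 * of_nat (card J - a) + (of_nat a / 2 + 2/3 * SA) \<le> sum_list (map weight \<sigma>)" .
  moreover have "rat_of_nat (card J - a) = of_nat (card J) - of_nat a"
    using card_mono[OF finJ AJ] by (simp add: a_def of_nat_diff)
  ultimately have W: "2/3 * of_nat (OPT \<sigma>) - of_nat a / 6 + 2/3 * SA \<le> of_nat (class_count 2 \<sigma>) / 2
      + of_nat (class_count 3 \<sigma>) / 3 + of_nat (class_count 4 \<sigma>) / 4 + 2/3 * S"
    unfolding sum_list_weight S_def optJ by linarith

  \<comment> \<open>Light bins compared with the largest items\<close>
  have "card (y ` A) \<le> card {i. i < length \<sigma> \<and> 1/2 \<le> \<sigma> ! i}"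
    by (rule card_mono) (use yn in \<open>force simp: n_def\<close>)+
  then have a_n2: "a \<le> n2 \<sigma>"
    using inj by (simp add: n2_def length_filter_conv_card card_image a_def)
  have n2n: "n2 \<sigma> \<le> n" by (simp add: n_def n2_le_length)

  \<comment> \<open>At most \<open>m - 1\<close> items exceed \<open>x_m\<close>, so in at least
    \<open>a - m + 1\<close> light bins the 2-item is at most \<open>x_m\<close>, and the small
    items there must supply \<open>1 - x_m\<close>.\<close>
  have xm: "3/4 < xm_of \<sigma> m \<and> xm_of \<sigma> m < 1 \<and>
      (\<exists>A'\<subseteq>A. a - m + 1 \<le> card A' \<and> (\<forall>j\<in>A'. 1 - xm_of \<sigma> m \<le> s j))"
    if m: "1 \<le> m" "m \<le> a" for m
  proof -
    define x where "x = xm_of \<sigma> m"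
    define A' where "A' = {j\<in>A. \<sigma> ! y j \<le> x}"
    have mlen: "m \<le> length \<sigma>" using m a_n2 n2n by (simp add: n_def)
    have "card (y ` (A - A')) \<le> card {i. i < length \<sigma> \<and> x < \<sigma> ! i}"
      by (rule card_mono) (use yn in \<open>force simp: n_def A'_def\<close>)+
    also have "\<dots> \<le> m - 1" using nth_largest(3)[OF m(1) mlen]
      by (simp add: length_filter_conv_card x_def)
    finally have "card (A - A') \<le> m - 1"
      using inj by (simp add: card_image inj_on_diff)
    moreover have "A' \<subseteq> A" by (auto simp: A'_def)
    ultimately have c: "a - m + 1 \<le> card A'"
      using finA m by (simp add: card_Diff_subset finite_subset a_def)
    then have "A' \<noteq> {}" by auto
    then obtain j where "j \<in> A" "\<sigma> ! y j \<le> x" by (auto simp: A'_def)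
    then have "3/4 < x" using yn(3) by fastforce
    moreover have "x < 1" using valid nth_largest(1)[OF m(1) mlen] by (simp add: x_def valid_input_def)
    moreover have "\<forall>j\<in>A'. 1 - x \<le> s j" using y by (fastforce simp: A'_def)
    ultimately show ?thesis using c \<open>A' \<subseteq> A\<close> unfolding x_def by blast
  qed

  \<comment> \<open>The choice of the number of critical bins\<close>
  define filled where "filled m \<longleftrightarrow> (\<forall>c\<in>set (fst (dh_run m (xm_of \<sigma> m) \<sigma>)). 1 \<le> vload (xm_of \<sigma> m) c)" for m
  have "filled 0"
  proof -
    obtain crit tb sb where run: "dh_run 0 1 \<sigma> = (crit, tb, sb)" by (metis prod_cases3)
    then have "crit = []" using run_cbin_ok[OF run valid] by simp
    then show ?thesis using run by (simp add: filled_def xm_of_def)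
  qed
  then obtain M where M: "M \<le> a div 2" "filled M" "M = a div 2 \<or> \<not> filled (Suc M)"
    by (rule last_before_failure)
  define x where "x = xm_of \<sigma> M"
  have x: "1/2 \<le> x" "x \<le> 1" "M \<le> length (filter (\<lambda>v. x \<le> v) \<sigma>)"
  proof -
    have "1/2 \<le> x \<and> x \<le> 1 \<and> M \<le> length (filter (\<lambda>v. x \<le> v) \<sigma>)"
    proof (cases "M = 0")
      case False
      then have "1 \<le> M" "M \<le> a" "M \<le> length \<sigma>" using M a_n2 n2n by (auto simp: n_def)
      then show ?thesis using xm[of M] nth_largest(2)[of M \<sigma>] unfolding x_def by auto
    qed (simp add: x_def xm_of_def)
    then show "1/2 \<le> x" "x \<le> 1" "M \<le> length (filter (\<lambda>v. x \<le> v) \<sigma>)" by auto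
  qed
  obtain crit tb sb where run: "dh_run M x \<sigma> = (crit, tb, sb)" by (metis prod_cases3)
  have "\<forall>c\<in>set crit. 1 \<le> vload x c" using M(2) run by (simp add: filled_def x_def)
  from covered_if_filled[OF run valid x this] obtain K where K:
    "K \<le> S" "K \<le> of_nat M * (5/4 - x)"
    "rat_of_nat (dh_covered (dh_run M x \<sigma>)) \<ge> of_nat M + (of_nat (class_count 2 \<sigma>) - of_nat M - 1) / 2
       + (of_nat (class_count 3 \<sigma>) - 2) / 3 + (of_nat (class_count 4 \<sigma>) - 3) / 4
       + 4/5 * (S - K - 1)"
    unfolding S_def by blast
  \<comment> \<open>The active bins lose 1/2 + 2/3 + 3/4 + 4/5 = 163/60. As
    \<open>K \<le> S\<close>, the factor 4/5 on \<open>S - K\<close> may be lowered to the 2/3 used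
    in the weights.\<close>
  have D: "rat_of_nat (dh_covered (dh_run M x \<sigma>)) \<ge>
      2/3 * of_nat (OPT \<sigma>) - of_nat a / 6 + 2/3 * SA + of_nat M / 2 - 2/3 * K - 163/60"
    using K(1,3) W by (simp add: field_simps)

  \<comment> \<open>What remains is to offset the deficit \<open>a/6\<close> up to 1/6, which turns
    163/60 into 173/60.\<close>
  have "rat_of_nat M / 2 + 2/3 * SA - 2/3 * K \<ge> of_nat a / 6 - 1/6"
  proof (cases "M = a div 2")
    case True
    \<comment> \<open>There are \<open>a - M + 1 \<ge> M\<close> light bins with small mass at least
      \<open>1 - x\<close>. They pay for all of \<open>K\<close> but \<open>M/4\<close>, leaving
      \<open>M/2 - M/6 = M/3\<close>.\<close>
    have "of_nat M * (1 - x) \<le> SA"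
    proof (cases "M = 0")
      case True
      then show ?thesis using s0 by (simp add: SA_def sum_nonneg)
    next
      case False
      then have "1 \<le> M" "M \<le> a" using M(1) by auto
      then obtain A' where A': "A' \<subseteq> A" "a - M + 1 \<le> card A'" "\<forall>j\<in>A'. 1 - x \<le> s j"
        using xm[of M] unfolding x_def by blast
      have "M \<le> card A'" using A'(2) M(1) by linarith
      then have "of_nat M * (1 - x) \<le> of_nat (card A') * (1 - x)"
        using x(2) by (intro mult_right_mono) auto
      also have "\<dots> \<le> sum s A'" using A'(3) by (metis sum_bounded_below)
      also have "\<dots> \<le> SA" unfolding SA_def using A'(1) finA s0 by (intro sum_mono2) auto
      finally show ?thesis .
    qed
    \<comment> \<open>Rounding in \<open>a div 2\<close> is what costs the 1/6.\<close>
    moreover have "rat_of_nat a \<le> 2 * of_nat M + 1"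
    proof -
      have "a \<le> 2 * M + 1" using True by linarith
      then have "rat_of_nat a \<le> of_nat (2 * M + 1)" by (rule of_nat_mono)
      then show ?thesis by simp
    qed
    ultimately show ?thesis using K(2) by (simp add: algebra_simps)
  next
    case False
    then have Ma: "Suc M \<le> a" and nf: "\<not> filled (Suc M)" using M by auto
    define x' where "x' = xm_of \<sigma> (Suc M)"
    define d where "d = 1 - x'"
    obtain A' where A': "A' \<subseteq> A" "a - Suc M + 1 \<le> card A'" "\<forall>j\<in>A'. d \<le> s j"
      and x': "3/4 < x'" "x' < 1"
      using xm[of "Suc M"] Ma by (auto simp: x'_def d_def)
    have d: "0 < d" "d < 1/4" using x' by (auto simp: d_def)
    obtain crit' tb' sb' where run': "dh_run (Suc M) x' \<sigma> = (crit', tb', sb')" by (metis prod_cases3)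
    obtain c where c: "c \<in> set crit'" "vload x' c < 1"
      using nf run' by (auto simp: filled_def x'_def not_le)
    have "sum_list (map (\<lambda>v. min (small_part v) d) \<sigma>) < (2 * of_nat (Suc M) - 1) * d"
      unfolding d_def by (rule truncated_mass_less_if_unfilled[OF run' valid _ x'(2) c]) (use x' in simp)
    then have T: "(\<Sum>i<n. min (small_part (\<sigma> ! i)) d) < (2 * of_nat M + 1) * d"
      by (simp add: sum_list_map_conv_sum n_def algebra_simps)
    \<comment> \<open>For \<open>p\<close> and \<open>d\<close> at most 1/4,
      \<open>min p d \<ge> 4 * d * p\<close>. Nonnegativity of this excess lets the truncated mass
      outside the light bins bound the true one: it is at least
      \<open>4 * d * (S - SA)\<close>.\<close>
    define q where "q i = min (small_part (\<sigma> ! i)) d - 4 * d * small_part (\<sigma> ! i)" for i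
    have q: "0 \<le> q i" if "i < n" for i
    proof -
      have "4 * d * small_part (\<sigma> ! i) \<le> 1 * small_part (\<sigma> ! i)"
        using d sp[OF that] by (intro mult_right_mono) auto
      moreover have "(4 * small_part (\<sigma> ! i)) * d \<le> 1 * d"
        using d sp[OF that] by (intro mult_right_mono) auto
      ultimately show ?thesis by (simp add: q_def min_def algebra_simps)
    qed
    \<comment> \<open>With \<open>m = M + 1\<close>, at least \<open>a - M\<close> light bins have
      small mass \<open>d\<close> or more, and truncating at \<open>d\<close> keeps \<open>d\<close>
      of it.\<close>
    have TA: "of_nat (a - M) * d \<le> (\<Sum>j\<in>A. \<Sum>i\<in>B j. min (small_part (\<sigma> ! i)) d)"
    proof -
      have "a - M \<le> card A'" using A'(2) Ma by linarith
      then have "of_nat (a - M) * d \<le> of_nat (card A') * d"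
        using d by (intro mult_right_mono) auto
      also have "\<dots> \<le> (\<Sum>j\<in>A'. \<Sum>i\<in>B j. min (small_part (\<sigma> ! i)) d)"
      proof (rule sum_bounded_below)
        fix j assume "j \<in> A'"
        then show "d \<le> (\<Sum>i\<in>B j. min (small_part (\<sigma> ! i)) d)"
          using A'(3) d sp by (intro sum_min_ge finB) (auto simp: s_def B_def)
      qed
      also have "\<dots> \<le> (\<Sum>j\<in>A. \<Sum>i\<in>B j. min (small_part (\<sigma> ! i)) d)"
        using A'(1) finA d sp by (intro sum_mono2 sum_nonneg) (auto simp: B_def)
      finally show ?thesis .
    qed
    have "(\<Sum>j\<in>A. \<Sum>i\<in>B j. q i) \<le> (\<Sum>i<n. q i)"
      unfolding B_def by (rule sum_fibres_le) (use finA q in auto)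
    moreover have "(\<Sum>j\<in>A. \<Sum>i\<in>B j. q i) = (\<Sum>j\<in>A. \<Sum>i\<in>B j. min (small_part (\<sigma> ! i)) d) - 4 * d * SA"
      by (simp add: q_def SA_def s_def sum_subtractf sum_distrib_left)
    moreover have "(\<Sum>i<n. q i) = (\<Sum>i<n. min (small_part (\<sigma> ! i)) d) - 4 * d * S"
      by (simp add: q_def S_def sum_list_map_conv_sum n_def sum_subtractf sum_distrib_left)
    ultimately have "of_nat (a - M) * d - 4 * d * SA < (2 * of_nat M + 1) * d - 4 * d * S"
      using T TA by linarith
    moreover have "rat_of_nat (a - M) = of_nat a - of_nat M" using Ma by (simp add: of_nat_diff)
    ultimately have "d * (4 * (S - SA)) < d * (3 * of_nat M + 1 - of_nat a)"
      by (simp add: algebra_simps)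
    then have "4 * (S - SA) < 3 * of_nat M + 1 - of_nat a" using d by simp
    \<comment> \<open>Even \<open>K = S\<close> suffices:
      \<open>M/2 - (3 * M + 1 - a) / 6 = (a - 1) / 6\<close>.\<close>
    then show ?thesis using K(1) by simp
  qed
  then have "rat_of_nat (dh_covered (dh_run M x \<sigma>)) \<ge> 2/3 * of_nat (OPT \<sigma>) - 173/60"
    using D by linarith
  moreover have "M \<le> n2 \<sigma>" using M(1) a_n2 by linarith
  ultimately show ?thesis unfolding x_def by blast
qed

section \<open>The oracle\<close>

text \<open>The maximum over the finite range of \<open>m\<close> is attained, so the choice
  operator returns a true maximiser.\<close>

lemma advisor_m:
  "advisor_m \<sigma> \<le> n2 \<sigma>"
  "m \<le> n2 \<sigma> \<Longrightarrow> dh_covered (dh_run m (xm_of \<sigma> m) \<sigma>)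
     \<le> dh_covered (dh_run (advisor_m \<sigma>) (xm_of \<sigma> (advisor_m \<sigma>)) \<sigma>)"
proof -
  let ?F = "\<lambda>m. dh_covered (dh_run m (xm_of \<sigma> m) \<sigma>)"
  have "Max (?F ` {..n2 \<sigma>}) \<in> ?F ` {..n2 \<sigma>}" by (rule Max_in) auto
  then obtain m where "m \<in> {..n2 \<sigma>}" "?F m = Max (?F ` {..n2 \<sigma>})" by fastforce
  then have m: "m \<le> n2 \<sigma>" "?F m = Max (?F ` {..n2 \<sigma>})" by simp_all
  have "?F m' \<le> ?F m" if "m' \<le> n2 \<sigma>" for m' unfolding m(2) using that by (intro Max_ge) auto
  with m(1) have "\<exists>m. m \<le> n2 \<sigma> \<and> (\<forall>m'\<le>n2 \<sigma>. ?F m' \<le> ?F m)" by blast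
  from someI_ex[OF this] show "advisor_m \<sigma> \<le> n2 \<sigma>"
    "m \<le> n2 \<sigma> \<Longrightarrow> ?F m \<le> ?F (advisor_m \<sigma>)" for m
    unfolding advisor_m_def by blast+
qed

lemma DH_read_advisor:
  assumes "valid_input \<sigma>"
  shows "DH_read (advisor \<sigma>) = (advisor_m \<sigma>, xm_of \<sigma> (advisor_m \<sigma>), [])"
    and "length (advisor \<sigma>) \<le> 3 * length (bin (advisor_m \<sigma>)) + 3 * bits \<sigma> + 9"
proof -
  define m where "m = advisor_m \<sigma>"
  define x where "x = xm_of \<sigma> m"
  obtain p q where pq: "quotient_of x = (p, q)" by (cases "quotient_of x")
  have adv: "advisor \<sigma> = enc m @ enc (nat p) @ enc (nat q)"
    using pq by (simp add: advisor_def Let_def m_def x_def)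
  have mlen: "m \<le> length \<sigma>"
    using advisor_m(1)[of \<sigma>] n2_le_length[of \<sigma>] by (simp add: m_def)
  have xset: "x \<in> set \<sigma>" if "m \<noteq> 0"
    using nth_largest(1)[of m \<sigma>] that mlen by (simp add: x_def)
  have x0: "m = 0 \<Longrightarrow> x = 1" by (simp add: x_def xm_of_def)
  then have "0 < x" using assms xset by (cases "m = 0") (auto simp: valid_input_def)
  then show "DH_read (advisor \<sigma>) = (advisor_m \<sigma>, xm_of \<sigma> (advisor_m \<sigma>), [])"
    unfolding adv DH_read_encoding[OF \<open>0 < x\<close> pq] by (simp add: m_def x_def)
  have "p > 0"
    using \<open>0 < x\<close> quotient_of_div[OF pq] quotient_of_denom_pos[OF pq] by (simp add: zero_less_divide_iff)
  \<comment> \<open>For \<open>m \<noteq> 0\<close> the value is an item of the input. For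
    \<open>m = 0\<close> it is the conventional 1, whose numerator and denominator take one bit
    each; hence the 2.\<close>
  have "length (bin (nat p)) + length (bin (nat q)) \<le> bits \<sigma> + 2"
  proof (cases "m = 0")
    case True
    then have "p = 1" "q = 1" using pq x0 by auto
    then show ?thesis by (simp add: bin.simps[of "Suc 0"] bin.simps[of 0])
  next
    case False
    have "rat_bits x \<le> bits \<sigma>" unfolding bits_def using xset[OF False] by (intro Max_ge) auto
    then show ?thesis using pq \<open>p > 0\<close> by (simp add: rat_bits_def)
  qed
  then show "length (advisor \<sigma>) \<le> 3 * length (bin (advisor_m \<sigma>)) + 3 * bits \<sigma> + 9"
    using length_enc[of m] length_enc[of "nat p"] length_enc[of "nat q"]
    unfolding adv m_def[symmetric] by simp
qed

theorem theorem2: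
  "\<exists>C::real. \<forall>\<sigma>. valid_input \<sigma> \<longrightarrow>
     real (advice_bits_read (advisor \<sigma>)) \<le> C * (real (bits \<sigma>) + log 2 (real (length \<sigma>) + 1) + 1)
     \<and> real (DH (advisor \<sigma>) \<sigma>) \<ge> 2/3 * real (OPT \<sigma>) - 173/60"
\<comment> \<open>The estimate below is 3 times the logarithm plus 3 times
  \<open>bits \<sigma>\<close> plus 3 + 9, so the constant 12 suffices.\<close>
proof (intro exI[of _ 12] allI impI conjI)
  fix \<sigma> assume valid: "valid_input \<sigma>"
  let ?m = "advisor_m \<sigma>"
  note read = DH_read_advisor[OF valid]
  have "real (advice_bits_read (advisor \<sigma>)) = real (length (advisor \<sigma>))"
    by (simp add: advice_bits_read_def read(1))
  also have "\<dots> \<le> 3 * real (length (bin ?m)) + 3 * real (bits \<sigma>) + 9"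
    using read(2) by linarith
  also have "\<dots> \<le> 3 * (1 + log 2 (real (length \<sigma>) + 1)) + 3 * real (bits \<sigma>) + 9"
  proof -
    have "?m \<le> length \<sigma>"
      using advisor_m(1)[of \<sigma>] n2_le_length[of \<sigma>] by simp
    then have "log 2 (real ?m + 1) \<le> log 2 (real (length \<sigma>) + 1)" by simp
    then have "real (length (bin ?m)) \<le> 1 + log 2 (real (length \<sigma>) + 1)"
      by (rule order_trans[OF length_bin_log add_left_mono])
    then show ?thesis by simp
  qed
  also have "\<dots> \<le> 12 * (real (bits \<sigma>) + log 2 (real (length \<sigma>) + 1) + 1)"
  proof -
    have "0 \<le> log 2 (real (length \<sigma>) + 1)" by simp
    then show ?thesis by simp
  qed
  finally show "real (advice_bits_read (advisor \<sigma>)) \<le> 12 * (real (bits \<sigma>) + log 2 (real (length \<sigma>) + 1) + 1)" .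

  obtain m where m: "m \<le> n2 \<sigma>"
    "rat_of_nat (dh_covered (dh_run m (xm_of \<sigma> m) \<sigma>)) \<ge> 2/3 * of_nat (OPT \<sigma>) - 173/60"
    using good_m_exists[OF valid] by blast
  have "DH (advisor \<sigma>) \<sigma> = dh_covered (dh_run ?m (xm_of \<sigma> ?m) \<sigma>)"
    by (simp add: DH_def read(1))
  then have "dh_covered (dh_run m (xm_of \<sigma> m) \<sigma>) \<le> DH (advisor \<sigma>) \<sigma>"
    using advisor_m(2)[OF m(1)] by simp
  then have "rat_of_nat (dh_covered (dh_run m (xm_of \<sigma> m) \<sigma>)) \<le> of_nat (DH (advisor \<sigma>) \<sigma>)"
    by (rule of_nat_mono)
  \<comment> \<open>Clearing denominators gives an inequality between natural numbers, which carries
    the bound from the rationals to the reals.\<close>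
  then have "60 * rat_of_nat (DH (advisor \<sigma>) \<sigma>) + 173 \<ge> 40 * of_nat (OPT \<sigma>)"
    using m(2) by linarith
  then have "rat_of_nat (40 * OPT \<sigma>) \<le> of_nat (60 * DH (advisor \<sigma>) \<sigma> + 173)" by simp
  then have "40 * OPT \<sigma> \<le> 60 * DH (advisor \<sigma>) \<sigma> + 173" by (simp only: of_nat_le_iff)
  then show "real (DH (advisor \<sigma>) \<sigma>) \<ge> 2/3 * real (OPT \<sigma>) - 173/60" by linarith
qed

end
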